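(* Let $\mu$ be a partition with $m\geq1$ corners and corner weights $x_0,x_1,\dots,x_m$ and $u_0,u_1,\dots,u_m$. Then for every $k=1,\dots,m$ the expression $$B^{(k)}_\mu(q,t)=\frac{e_k[x_0+\cdots+x_m]-e_k[u_0+\cdots+u_m]}{(1-1/t)(1-1/q)}$$ is a polynomial in $q,t$ with positive integer coefficients.
   Context: Partitions in French convention; cell $(i,j)$ is the $j$-th cell of the $i$-th row from the bottom, with coleg $i-1$ and coarm $j-1$. A corner cell is one whose removal leaves a partition; order the $m$ corners $A_1,\dots,A_m$ from left to right. If $A_i$ has coleg $l_i$ and coarm $a_i$, set $x_i=t^{l_i}q^{a_i}$ ($1\le i\le m$), $x_0=1/(tq)$, $u_0=t^{l_1}/q$, $u_i=t^{l_{i+1}}q^{a_i}$ ($1\le i\le m-1$), $u_m=q^{a_m}/t$. $e_k[y_0+\cdots+y_m]$ denotes the $k$-th elementary symmetric function of $y_0,\dots,y_m$. *)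

theory Defs
  imports "HOL-Computational_Algebra.Computational_Algebra"
begin

definition is_partition :: "nat list \<Rightarrow> bool" where
  "is_partition \<mu> \<longleftrightarrow> sorted_wrt (\<ge>) \<mu> \<and> 0 \<notin> set \<mu>"

(* French convention: (i, j) is the j-th cell of the i-th row from the bottom, both counted from 1;
   the bottom row is the largest part. *)
definition cells :: "nat list \<Rightarrow> (nat \<times> nat) set" where
  "cells \<mu> = {(i, j). 1 \<le> i \<and> i \<le> length \<mu> \<and> 1 \<le> j \<and> j \<le> \<mu> ! (i - 1)}"

definition coleg :: "nat \<times> nat \<Rightarrow> nat" where
  "coleg c = fst c - 1"

definition coarm :: "nat \<times> nat \<Rightarrow> nat" where
  "coarm c = snd c - 1"

definition corners :: "nat list \<Rightarrow> (nat \<times> nat) set" where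
  "corners \<mu> = {c \<in> cells \<mu>. \<exists>\<nu>. is_partition \<nu> \<and> cells \<nu> = cells \<mu> - {c}}"

(* Left to right means by increasing column. Distinct corners of a partition lie in distinct
   columns, so the list exists and is unique (ex1_corner_list). *)
definition corner_list :: "nat list \<Rightarrow> (nat \<times> nat) list" where
  "corner_list \<mu> =
     (THE cs. set cs = corners \<mu> \<and> sorted_wrt (\<lambda>c d. snd c < snd d) cs)"

definition num_corners :: "nat list \<Rightarrow> nat" where
  "num_corners \<mu> = card (corners \<mu>)"

(* The corner A_i, for 1 <= i <= num_corners \<mu>. *)
definition corner :: "nat list \<Rightarrow> nat \<Rightarrow> nat \<times> nat" where
  "corner \<mu> i = corner_list \<mu> ! (i - 1)"

definition weight_x :: "'a::field \<Rightarrow> 'a \<Rightarrow> nat list \<Rightarrow> nat \<Rightarrow> 'a" where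
  "weight_x q t \<mu> i =
     (if i = 0 then 1 / (t * q)
      else t ^ coleg (corner \<mu> i) * q ^ coarm (corner \<mu> i))"

(* Meant for num_corners \<mu> >= 1, so that the first and last index are different. *)
definition weight_u :: "'a::field \<Rightarrow> 'a \<Rightarrow> nat list \<Rightarrow> nat \<Rightarrow> 'a" where
  "weight_u q t \<mu> i =
     (if i = 0 then t ^ coleg (corner \<mu> 1) / q
      else if i < num_corners \<mu> then t ^ coleg (corner \<mu> (i + 1)) * q ^ coarm (corner \<mu> i)
      else q ^ coarm (corner \<mu> i) / t)"

(* e_k[y_0 + ... + y_m] *)
definition elem_sym :: "nat \<Rightarrow> nat \<Rightarrow> (nat \<Rightarrow> 'a::comm_ring_1) \<Rightarrow> 'a" where
  "elem_sym k m y = (\<Sum>S | S \<subseteq> {0..m} \<and> card S = k. \<Prod>i\<in>S. y i)"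

definition B_expr :: "'a::field \<Rightarrow> 'a \<Rightarrow> nat list \<Rightarrow> nat \<Rightarrow> 'a" where
  "B_expr q t \<mu> k =
     (elem_sym k (num_corners \<mu>) (weight_x q t \<mu>) - elem_sym k (num_corners \<mu>) (weight_u q t \<mu>))
     / ((1 - 1 / t) * (1 - 1 / q))"

(* The field of rational functions Q(q, t) is the fraction field of Z[q][t] = int poly poly, where
   q is the inner and t the outer variable: coeff (coeff P i) j is the coefficient of t^i q^j. *)
definition q_var :: "int poly poly fract" where
  "q_var = to_fract [:[:0, 1:]:]"

definition t_var :: "int poly poly fract" where
  "t_var = to_fract [:0, 1:]"

(* Membership in N[q, t]: every coefficient that occurs is a positive integer. *)
definition is_positive_poly :: "int poly poly fract \<Rightarrow> bool" where
  "is_positive_poly f \<longleftrightarrow>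
     (\<exists>P :: int poly poly. f = to_fract P \<and> (\<forall>i j. coeff (coeff P i) j \<ge> 0))"

lemma finite_cells: "finite (cells \<mu>)"
proof (rule finite_subset)
  show "cells \<mu> \<subseteq> (\<Union>i\<in>{0..length \<mu>}. {i} \<times> {0..\<mu> ! (i - 1)})"
    by (auto simp: cells_def)
qed simp

lemma finite_corners: "finite (corners \<mu>)"
  by (rule finite_subset[OF _ finite_cells[of \<mu>]]) (auto simp: corners_def)

lemma cells_down_closed:
  assumes "is_partition \<nu>" "(i', j) \<in> cells \<nu>" "1 \<le> i" "i \<le> i'"
  shows "(i, j) \<in> cells \<nu>"
proof (cases "i = i'")
  case False
  have "\<nu> ! (i' - 1) \<le> \<nu> ! (i - 1)"
    using assms False by (auto simp: is_partition_def cells_def sorted_wrt_iff_nth_less)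
  then show ?thesis using assms by (auto simp: cells_def)
qed (use assms in simp)

lemma inj_on_snd_corners: "inj_on snd (corners \<mu>)"
proof -
  have False if "(i, j) \<in> corners \<mu>" "(i', j) \<in> corners \<mu>" "i < i'" for i i' j
  proof -
    obtain \<nu> where \<nu>: "is_partition \<nu>" "cells \<nu> = cells \<mu> - {(i, j)}"
      using \<open>(i, j) \<in> corners \<mu>\<close> by (auto simp: corners_def)
    have "(i', j) \<in> cells \<nu>" "1 \<le> i" using \<nu>(2) that by (auto simp: corners_def cells_def)
    from cells_down_closed[OF \<nu>(1) this] \<nu>(2) \<open>i < i'\<close> show False by auto
  qed
  then show ?thesis
    unfolding inj_on_def by (metis linorder_neqE_nat prod.collapse)
qed

lemma ex1_corner_list:
  "\<exists>!cs. set cs = corners \<mu> \<and> sorted_wrt (\<lambda>c d. snd c < snd d) cs"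
proof (rule ex_ex1I)
  interpret folding_insort_key "(\<le>)" "(<)" "corners \<mu>" snd
    by standard (rule inj_on_snd_corners)
  obtain cs where "sorted_wrt (<) (map snd cs)" "set cs = corners \<mu>"
    using finite_set_strict_sorted[OF order_refl finite_corners] by metis
  then show "\<exists>cs. set cs = corners \<mu> \<and> sorted_wrt (\<lambda>c d. snd c < snd d) cs"
    by (auto simp: sorted_wrt_map)
next
  fix cs ds
  assume cs: "set cs = corners \<mu> \<and> sorted_wrt (\<lambda>c d. snd c < snd d) cs"
    and ds: "set ds = corners \<mu> \<and> sorted_wrt (\<lambda>c d. snd c < snd d) ds"
  have "map snd ds = map snd cs"
    by (rule strict_sorted_equal) (use cs ds in \<open>simp_all add: sorted_wrt_map\<close>)
  then show "cs = ds"
    using map_inj_on[of snd cs ds] cs ds inj_on_snd_corners[of \<mu>] by simp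
qed

lemma
  shows set_corner_list: "set (corner_list \<mu>) = corners \<mu>"
    and sorted_corner_list: "sorted_wrt (\<lambda>c d. snd c < snd d) (corner_list \<mu>)"
  using theI'[OF ex1_corner_list[of \<mu>]] by (simp_all add: corner_list_def)

lemma length_corner_list: "length (corner_list \<mu>) = num_corners \<mu>"
proof -
  have "distinct (map snd (corner_list \<mu>))"
    using sorted_corner_list[of \<mu>] by (simp add: strict_sorted_iff flip: sorted_wrt_map)
  then show ?thesis
    by (metis distinct_card distinct_map num_corners_def set_corner_list)
qed

end

(* Put T_0 = 1/t, Q_0 = 1/q, T_i = t^(l_i) and Q_i = q^(a_i), so that x_i = T_i Q_i and
   u_i = T_{i+1} Q_i, where T_{m+1} is read as T_0. Write F(k, m) = e_k[x] - e_k[u] for the first m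
   corners. Adding the corner m + 1 replaces the single weight T_0 Q_m among the u_i by
   T_{m+1} Q_m and T_0 Q_{m+1}. The product of these two is (T_0 Q_m) x_{m+1}, while their sum is
   T_0 Q_m + x_{m+1} - (T_{m+1} - T_0)(Q_{m+1} - Q_m). Hence
     F(k+1, m+1) = F(k+1, m) + x_{m+1} F(k, m)
                   + (T_{m+1} - T_0)(Q_{m+1} - Q_m) e_k[u_0 + ... + u_{m-1}],
   and after division by (1 - 1/t)(1 - 1/q) the last term has positive coefficients: the pole
   of u_0 at q = 0 is cancelled by the factor q^(a_m + 1). Induction on m concludes. *)

theory Submission
  imports Defs
begin

section \<open>Elementary symmetric functions of a finite family\<close>

text \<open>The index set is arbitrary, so that single indices can be split off at either end: the
  top one in the recursion, and index 0, which carries the pole.\<close>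

definition esym :: "nat \<Rightarrow> 'b set \<Rightarrow> ('b \<Rightarrow> 'a::comm_ring_1) \<Rightarrow> 'a" where
  "esym k A y = (\<Sum>S | S \<subseteq> A \<and> card S = k. \<Prod>i\<in>S. y i)"

lemma elem_sym_eq_esym: "elem_sym k m y = esym k {..m} y"
  by (simp add: elem_sym_def esym_def atLeast0AtMost)

lemma esym_cong:
  assumes "\<And>i. i \<in> A \<Longrightarrow> y i = z i"
  shows "esym k A y = esym k A z"
  unfolding esym_def by (intro sum.cong prod.cong refl assms) auto

lemma esym_0:
  assumes "finite A"
  shows "esym 0 A y = 1"
proof -
  have "{S. S \<subseteq> A \<and> card S = 0} = {{}}"
    using assms by (auto dest: finite_subset)
  then show ?thesis by (simp add: esym_def)
qed

lemma esym_Suc_empty: "esym (Suc k) {} y = 0"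
  unfolding esym_def by (rule sum.neutral) auto

text \<open>A subset of size \<open>Suc k\<close> either avoids \<open>a\<close> or arises from a
  unique subset of \<open>A\<close> of size \<open>k\<close> by inserting \<open>a\<close>.\<close>

lemma esym_Suc_insert:
  assumes "finite A" "a \<notin> A"
  shows "esym (Suc k) (insert a A) y = esym (Suc k) A y + y a * esym k A y"
proof -
  let ?N = "\<lambda>k. {S. S \<subseteq> A \<and> card S = k}"
  have fin: "finite (?N k)" for k
    using assms(1) by simp
  have notin: "a \<notin> S" "finite S" if "S \<subseteq> A" for S
    using that assms by (auto dest: finite_subset)
  have split: "{S. S \<subseteq> insert a A \<and> card S = Suc k} = ?N (Suc k) \<union> insert a ` ?N k"
  proof (intro equalityI subsetI)
    fix S assume S: "S \<in> {S. S \<subseteq> insert a A \<and> card S = Suc k}"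
    show "S \<in> ?N (Suc k) \<union> insert a ` ?N k"
    proof (cases "a \<in> S")
      case True
      then have "S = insert a (S - {a})" "S - {a} \<in> ?N k"
        using S by auto
      then show ?thesis by blast
    qed (use S in auto)
  qed (use notin in auto)
  have inj: "inj_on (insert a) (?N k)"
    using notin by (intro inj_onI) (metis (lifting) insert_ident mem_Collect_eq)
  have "esym (Suc k) (insert a A) y
      = esym (Suc k) A y + (\<Sum>S\<in>insert a ` ?N k. \<Prod>i\<in>S. y i)"
    unfolding esym_def split
    by (rule sum.union_disjoint) (use fin notin in auto)
  also have "(\<Sum>S\<in>insert a ` ?N k. \<Prod>i\<in>S. y i) = (\<Sum>S\<in>?N k. y a * (\<Prod>i\<in>S. y i))"
    unfolding sum.reindex[OF inj] by (rule sum.cong) (use notin in auto)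
  finally show ?thesis
    by (simp add: esym_def sum_distrib_left)
qed

lemma esym_Suc_atMost:
  "esym (Suc k) {..Suc m} y = esym (Suc k) {..m} y + y (Suc m) * esym k {..m} y"
  by (simp add: atMost_Suc esym_Suc_insert)

lemma esym_Suc_atMost_lessThan:
  fixes m :: nat
  shows "esym (Suc k) {..m} y = esym (Suc k) {..<m} y + y m * esym k {..<m} y"
  unfolding lessThan_Suc_atMost[symmetric] lessThan_Suc by (rule esym_Suc_insert) auto

section \<open>The difference of symmetric functions and its recursion in the number of
  corners\<close>

text \<open>The weights u: the factors \<open>T\<close> are shifted cyclically by one against
  \<open>Q\<close>. Passing from \<open>m\<close> to \<open>Suc m\<close> changes only the value at
  index \<open>m\<close> and adds one at \<open>Suc m\<close>.\<close>

definition cyc_u :: "(nat \<Rightarrow> 'a::comm_ring_1) \<Rightarrow> (nat \<Rightarrow> 'a) \<Rightarrow> nat \<Rightarrow> nat \<Rightarrow> 'a" where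
  "cyc_u T Q m i = (if i < m then T (Suc i) else T 0) * Q i"

definition esym_diff :: "(nat \<Rightarrow> 'a::comm_ring_1) \<Rightarrow> (nat \<Rightarrow> 'a) \<Rightarrow> nat \<Rightarrow> nat \<Rightarrow> 'a" where
  "esym_diff T Q k m = esym k {..m} (\<lambda>i. T i * Q i) - esym k {..m} (cyc_u T Q m)"

lemma esym_diff_0_left: "esym_diff T Q 0 m = 0"
  by (simp add: esym_diff_def esym_0)

text \<open>With the single index 0 the cyclic shift is trivial, so both families agree; this starts
  the induction.\<close>

lemma esym_diff_0_right: "esym_diff T Q k 0 = 0"
proof -
  have "esym k {..0} (\<lambda>i. T i * Q i) = esym k {..0} (cyc_u T Q 0)"
    by (rule esym_cong) (simp add: cyc_u_def)
  then show ?thesis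
    by (simp add: esym_diff_def)
qed

lemma esym_diff_Suc:
  "esym_diff T Q (Suc k) (Suc m) =
     esym_diff T Q (Suc k) m + T (Suc m) * Q (Suc m) * esym_diff T Q k m
     + (T (Suc m) - T 0) * (Q (Suc m) - Q m) * esym k {..<m} (\<lambda>i. T (Suc i) * Q i)"
proof -
  let ?v = "\<lambda>i. T (Suc i) * Q i"
  let ?x = "\<lambda>i. T i * Q i"
  have less: "esym j {..<m} (cyc_u T Q m) = esym j {..<m} ?v"
    "esym j {..<m} (cyc_u T Q (Suc m)) = esym j {..<m} ?v" for j
    by (auto simp: cyc_u_def intro!: esym_cong)
  have val: "cyc_u T Q m m = T 0 * Q m" "cyc_u T Q (Suc m) m = T (Suc m) * Q m"
    "cyc_u T Q (Suc m) (Suc m) = T 0 * Q (Suc m)"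
    by (simp_all add: cyc_u_def)
  show ?thesis
  \<comment> \<open>The product of the two new weights enters with a symmetric function of degree
    \<open>k - 1\<close>, so degree \<open>k = 0\<close> has no such term and is treated
    apart.\<close>
  proof (cases k)
    case 0
    then show ?thesis
      unfolding esym_diff_def 0 esym_Suc_atMost unfolding esym_Suc_atMost_lessThan less val
      by (simp add: esym_0 algebra_simps)
  next
    case (Suc j)
    \<comment> \<open>Both sides are reduced to the common family \<open>?v\<close> below
      \<open>m\<close>. The x-weights are only split at \<open>Suc m\<close>, since their remaining
      sums over \<open>{..m}\<close> cancel.\<close>
    have u: "esym (Suc k) {..Suc m} (cyc_u T Q (Suc m)) =
        esym (Suc k) {..<m} ?v + T (Suc m) * Q m * esym k {..<m} ?v
        + T 0 * Q (Suc m) * (esym k {..<m} ?v + T (Suc m) * Q m * esym j {..<m} ?v)"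
      unfolding esym_Suc_atMost unfolding Suc esym_Suc_atMost_lessThan less val ..
    have u': "esym (Suc i) {..m} (cyc_u T Q m) = esym (Suc i) {..<m} ?v + T 0 * Q m * esym i {..<m} ?v"
      for i
      unfolding esym_Suc_atMost_lessThan less val ..
    show ?thesis
      unfolding esym_diff_def u esym_Suc_atMost[of k m ?x] unfolding Suc u'
      by (simp add: algebra_simps)
  qed
qed

section \<open>Closure properties of polynomials with nonnegative coefficients\<close>

lemma is_positive_poly_0: "is_positive_poly 0"
  unfolding is_positive_poly_def by (intro exI[of _ 0]) simp

lemma is_positive_poly_1: "is_positive_poly 1"
  unfolding is_positive_poly_def by (intro exI[of _ 1]) (auto simp: coeff_1)

lemma is_positive_poly_add:
  "is_positive_poly f \<Longrightarrow> is_positive_poly g \<Longrightarrow> is_positive_poly (f + g)"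
  unfolding is_positive_poly_def by (metis to_fract_add add_nonneg_nonneg coeff_add)

lemma is_positive_poly_mult:
  assumes "is_positive_poly f" "is_positive_poly g"
  shows "is_positive_poly (f * g)"
proof -
  obtain P R where P: "f = to_fract P" "\<And>i j. coeff (coeff P i) j \<ge> 0"
    and R: "g = to_fract R" "\<And>i j. coeff (coeff R i) j \<ge> 0"
    using assms unfolding is_positive_poly_def by blast
  have "coeff (coeff (P * R) i) j \<ge> 0" for i j
    by (auto simp: coeff_mult coeff_sum P R intro!: sum_nonneg mult_nonneg_nonneg)
  then show ?thesis
    unfolding is_positive_poly_def using P R by (intro exI[of _ "P * R"]) simp
qed

lemma is_positive_poly_sum:
  "(\<And>i. i \<in> A \<Longrightarrow> is_positive_poly (f i)) \<Longrightarrow> is_positive_poly (sum f A)"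
  by (induction A rule: infinite_finite_induct) (simp_all add: is_positive_poly_0 is_positive_poly_add)

lemma is_positive_poly_prod:
  "(\<And>i. i \<in> A \<Longrightarrow> is_positive_poly (f i)) \<Longrightarrow> is_positive_poly (prod f A)"
  by (induction A rule: infinite_finite_induct) (simp_all add: is_positive_poly_1 is_positive_poly_mult)

lemma is_positive_poly_power: "is_positive_poly f \<Longrightarrow> is_positive_poly (f ^ n)"
  by (induction n) (simp_all add: is_positive_poly_1 is_positive_poly_mult)

lemma is_positive_poly_esym:
  "(\<And>i. i \<in> A \<Longrightarrow> is_positive_poly (y i)) \<Longrightarrow> is_positive_poly (esym k A y)"
  unfolding esym_def by (intro is_positive_poly_sum is_positive_poly_prod) auto

lemmas is_positive_poly_intros =
  is_positive_poly_0 is_positive_poly_1 is_positive_poly_add is_positive_poly_mult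
  is_positive_poly_sum is_positive_poly_power is_positive_poly_esym

lemma is_positive_poly_q_var: "is_positive_poly q_var"
  unfolding is_positive_poly_def q_var_def
  by (intro exI[of _ "[:[:0, 1:]:]"]) (auto simp: coeff_pCons split: nat.split)

lemma is_positive_poly_t_var: "is_positive_poly t_var"
  unfolding is_positive_poly_def t_var_def
  by (intro exI[of _ "[:0, 1:]"]) (auto simp: coeff_pCons split: nat.split)

lemma q_var_neq: "q_var \<noteq> 0" "q_var \<noteq> 1"
  by (simp_all add: q_var_def to_fract_eq_0_iff one_pCons flip: to_fract_1)

lemma t_var_neq: "t_var \<noteq> 0" "t_var \<noteq> 1"
  by (simp_all add: t_var_def to_fract_eq_0_iff one_pCons flip: to_fract_1)

section \<open>Positivity of the recursion after division\<close>

text \<open>Index 0 stands for the exponent -1, which a natural-valued \<open>e\<close> cannot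
  express.\<close>

definition weight_pow :: "'a::field \<Rightarrow> (nat \<Rightarrow> nat) \<Rightarrow> nat \<Rightarrow> 'a" where
  "weight_pow z e i = (if i = 0 then 1 / z else z ^ e i)"

text \<open>A geometric sum. The separate factor \<open>z\<close>, coming from
  \<open>1 - 1 / z = (z - 1) / z\<close>, is kept visible because it later absorbs the pole of
  u_0.\<close>

lemma power_diff_quotient:
  fixes z :: "'a::field"
  assumes "z \<noteq> 0" "z \<noteq> 1" "b \<le> c"
  shows "(z ^ c - z ^ b) / (1 - 1 / z) = z * z ^ b * (\<Sum>i<c - b. z ^ i)"
proof -
  have "(z - 1) * (\<Sum>i<c - b. z ^ i) = z ^ (c - b) - 1"
    by (rule power_diff_1_eq[symmetric])
  then have "z ^ c - z ^ b = z ^ b * ((z - 1) * (\<Sum>i<c - b. z ^ i))"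
    using assms(3) by (simp add: right_diff_distrib flip: power_add)
  moreover have "z - 1 \<noteq> 0" "1 - 1 / z = (z - 1) / z"
    using assms by (simp_all add: field_simps)
  ultimately show ?thesis
    by simp
qed

text \<open>The same geometric sum with lower exponent -1; here the extra factor \<open>z\<close> is
  used up by \<open>1 / z\<close>.\<close>

lemma power_diff_inverse_quotient:
  fixes z :: "'a::field"
  assumes "z \<noteq> 0" "z \<noteq> 1"
  shows "(z ^ c - 1 / z) / (1 - 1 / z) = (\<Sum>i\<le>c. z ^ i)"
proof -
  have "(z - 1) * (\<Sum>i\<le>c. z ^ i) = z ^ Suc c - 1"
    unfolding lessThan_Suc_atMost[symmetric] by (rule power_diff_1_eq[symmetric])
  then have "z ^ c - 1 / z = (z - 1) * (\<Sum>i\<le>c. z ^ i) / z"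
    using assms(1) by (simp add: field_simps)
  moreover have "z - 1 \<noteq> 0" "1 - 1 / z = (z - 1) / z"
    using assms by (simp_all add: field_simps)
  ultimately show ?thesis
    using assms(1) by simp
qed

text \<open>The only negative power in the symmetric function is the factor \<open>1 / q\<close> at
  index 0, and each product contains it at most once. A single spare factor \<open>q\<close> from
  the quotient of the \<open>Q\<close> difference therefore suffices.\<close>

lemma is_positive_poly_correction_term:
  fixes a l :: "nat \<Rightarrow> nat"
  assumes q: "q \<noteq> 0" "q \<noteq> 1" "is_positive_poly q"
    and t: "t \<noteq> 0" "t \<noteq> 1" "is_positive_poly t"
    and mono: "m \<ge> 1 \<Longrightarrow> a m \<le> a (Suc m)"
  defines "T \<equiv> weight_pow t l" and "Q \<equiv> weight_pow q a"
  shows "is_positive_poly ((T (Suc m) - T 0) / (1 - 1 / t) * ((Q (Suc m) - Q m) / (1 - 1 / q))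
           * esym k {..<m} (\<lambda>i. T (Suc i) * Q i))"
proof -
  have Tpos: "is_positive_poly (T (Suc i))" for i
    using t by (simp add: T_def weight_pow_def is_positive_poly_intros)
  have "(T (Suc m) - T 0) / (1 - 1 / t) = (\<Sum>i\<le>l (Suc m). t ^ i)"
    using power_diff_inverse_quotient[OF t(1,2)] by (simp add: T_def weight_pow_def)
  then have 1: "is_positive_poly ((T (Suc m) - T 0) / (1 - 1 / t))"
    using t by (simp add: is_positive_poly_intros)
  have 2: "is_positive_poly ((Q (Suc m) - Q m) / (1 - 1 / q) * esym k {..<m} (\<lambda>i. T (Suc i) * Q i))"
  \<comment> \<open>For \<open>m = 0\<close> the subtracted term \<open>Q 0\<close> is itself
    \<open>1 / q\<close>, which leaves no spare \<open>q\<close>, but the index set is empty and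
    there is no pole. For \<open>m > 0\<close> the pole and the spare factor both appear.\<close>
  proof (cases m)
    case 0
    have "(Q (Suc m) - Q m) / (1 - 1 / q) = (\<Sum>i\<le>a (Suc m). q ^ i)"
      using power_diff_inverse_quotient[OF q(1,2)] by (simp add: Q_def weight_pow_def 0)
    then show ?thesis
      using q 0 by (auto intro!: is_positive_poly_intros)
  next
    case (Suc n)
    let ?v = "\<lambda>i. T (Suc i) * Q i"
    have rest: "is_positive_poly (esym j {1..<m} ?v)" for j
      using Tpos q by (intro is_positive_poly_intros) (auto simp: Q_def weight_pow_def is_positive_poly_intros)
    have "{..<m} = insert 0 {1..<m}"
      using Suc by auto
    \<comment> \<open>Splitting off index 0, whose value is \<open>T 1 / q\<close>; multiplication
      by \<open>q\<close> turns it into \<open>T 1\<close>.\<close>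
    then have "q * esym (Suc j) {..<m} ?v = q * esym (Suc j) {1..<m} ?v + T 1 * esym j {1..<m} ?v" for j
      using q by (simp add: esym_Suc_insert Q_def weight_pow_def field_simps)
    then have e: "is_positive_poly (q * esym k {..<m} ?v)"
      using Tpos[of 0] q rest by (cases k) (simp_all add: esym_0 is_positive_poly_intros)
    have "(Q (Suc m) - Q m) / (1 - 1 / q) = q * q ^ a m * (\<Sum>i<a (Suc m) - a m. q ^ i)"
      using power_diff_quotient[OF q(1,2) mono] Suc by (simp add: Q_def weight_pow_def)
    then have "(Q (Suc m) - Q m) / (1 - 1 / q) * esym k {..<m} ?v =
        q ^ a m * (\<Sum>i<a (Suc m) - a m. q ^ i) * (q * esym k {..<m} ?v)"
      by (simp only: ac_simps)
    then show ?thesis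
      using e q by (simp add: is_positive_poly_intros)
  qed
  show ?thesis
    using is_positive_poly_mult[OF 1 2] by (simp only: mult.assoc)
qed

text \<open>Induction on \<open>m\<close> with \<open>k\<close> arbitrary, since the recursion also
  calls the degree one lower.\<close>

lemma is_positive_poly_esym_diff:
  assumes q: "q \<noteq> 0" "q \<noteq> 1" "is_positive_poly q"
    and t: "t \<noteq> 0" "t \<noteq> 1" "is_positive_poly t"
    and mono: "\<And>i. 1 \<le> i \<Longrightarrow> i < m \<Longrightarrow> a i \<le> a (Suc i)"
  shows "is_positive_poly
           (esym_diff (weight_pow t l) (weight_pow q a) k m / ((1 - 1 / t) * (1 - 1 / q)))"
  using mono
proof (induction m arbitrary: k)
  case 0
  then show ?case by (simp add: esym_diff_0_right is_positive_poly_0)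
next
  case (Suc m)
  define T where "T = weight_pow t l"
  define Q where "Q = weight_pow q a"
  define D where "D = (1 - 1 / t) * (1 - 1 / q)"
  have IH: "is_positive_poly (esym_diff T Q k m / D)" for k
    unfolding T_def Q_def D_def by (rule Suc.IH) (use Suc.prems in auto)
  show ?case
  proof (cases k)
    case 0
    then show ?thesis by (simp add: esym_diff_0_left is_positive_poly_0)
  next
    case (Suc j)
    \<comment> \<open>In the last term each of the two factors of \<open>D\<close> divides its own
      difference.\<close>
    have "esym_diff T Q (Suc j) (Suc m) / D =
        esym_diff T Q (Suc j) m / D + T (Suc m) * Q (Suc m) * (esym_diff T Q j m / D)
        + (T (Suc m) - T 0) / (1 - 1 / t) * ((Q (Suc m) - Q m) / (1 - 1 / q))
           * esym j {..<m} (\<lambda>i. T (Suc i) * Q i)"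
      unfolding esym_diff_Suc by (simp add: add_divide_distrib D_def)
    moreover have "is_positive_poly (T (Suc m) * Q (Suc m))"
      using q t by (simp add: T_def Q_def weight_pow_def is_positive_poly_intros)
    moreover have "is_positive_poly ((T (Suc m) - T 0) / (1 - 1 / t)
        * ((Q (Suc m) - Q m) / (1 - 1 / q)) * esym j {..<m} (\<lambda>i. T (Suc i) * Q i))"
      unfolding T_def Q_def
      by (rule is_positive_poly_correction_term) (use q t Suc.prems in auto)
    ultimately have "is_positive_poly (esym_diff T Q (Suc j) (Suc m) / D)"
      by (simp only: is_positive_poly_add is_positive_poly_mult IH)
    then show ?thesis
      by (simp only: Suc T_def Q_def D_def)
  qed
qed

section \<open>Specialisation to the corners of a partition\<close>

text \<open>Columns increase strictly along the corner list; the truncated subtraction in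
  \<open>coarm\<close> preserves at least the weak inequality, which is enough for the geometric
  sum.\<close>

lemma coarm_corner_mono:
  assumes "1 \<le> i" "i < num_corners \<mu>"
  shows "coarm (corner \<mu> i) \<le> coarm (corner \<mu> (Suc i))"
proof -
  \<comment> \<open>Corners are counted from 1 and list positions from 0, so these entries are the
    corners \<open>i\<close> and \<open>Suc i\<close>.\<close>
  have "snd (corner_list \<mu> ! (i - 1)) < snd (corner_list \<mu> ! i)"
    using sorted_corner_list[of \<mu>] assms
    by (auto simp: sorted_wrt_iff_nth_less length_corner_list)
  then show ?thesis by (simp add: corner_def coarm_def)
qed

lemma B_expr_eq_esym_diff:
  assumes "num_corners \<mu> \<ge> 1"
  shows "B_expr q t \<mu> k =
    esym_diff (weight_pow t (\<lambda>i. coleg (corner \<mu> i))) (weight_pow q (\<lambda>i. coarm (corner \<mu> i)))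
      k (num_corners \<mu>) / ((1 - 1 / t) * (1 - 1 / q))"
proof -
  let ?T = "weight_pow t (\<lambda>i. coleg (corner \<mu> i))"
  let ?Q = "weight_pow q (\<lambda>i. coarm (corner \<mu> i))"
  let ?m = "num_corners \<mu>"
  have "esym k {..?m} (weight_x q t \<mu>) = esym k {..?m} (\<lambda>i. ?T i * ?Q i)"
    by (rule esym_cong) (simp add: weight_x_def weight_pow_def)
  \<comment> \<open>At least one corner is needed here: index 0 must fall under the shifted case,
    giving \<open>?T 1 * ?Q 0\<close>, and the last index must differ from 0.\<close>
  moreover have "esym k {..?m} (weight_u q t \<mu>) = esym k {..?m} (cyc_u ?T ?Q ?m)"
    by (rule esym_cong) (use assms in \<open>auto simp: weight_u_def weight_pow_def cyc_u_def\<close>)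
  ultimately show ?thesis
    by (simp add: B_expr_def elem_sym_eq_esym esym_diff_def)
qed

theorem theorem3p4:
  fixes \<mu> :: "nat list" and k :: nat
  assumes "is_partition \<mu>"
    and "num_corners \<mu> \<ge> 1"
    and "1 \<le> k" and "k \<le> num_corners \<mu>"
  shows "is_positive_poly (B_expr q_var t_var \<mu> k)"
  unfolding B_expr_eq_esym_diff[OF assms(2)]
  by (intro is_positive_poly_esym_diff q_var_neq t_var_neq is_positive_poly_q_var
      is_positive_poly_t_var coarm_corner_mono)

end
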